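(* Let $z$, $u$ and $X=\{X_1,X_2,X_3,\ldots\}$ be independent indeterminates. For all integers $n,r\ge 1$ one has, as an identity of formal power series in $u$ with coefficients in $\mathbb{Q}[z,X_1,X_2,\ldots]$, $$\sum_{|\mu|=n}(-1)^{r-l(\mu)}\,\frac{\left\langle {\mu\atop r}\right\rangle}{z_\mu}\,\prod_{i\ge 1}\left(z+\sum_{k\ge 1}u^k\,\frac{(i)_k}{k!}\,X_k\right)^{m_i(\mu)}=\sum_{j\ge 0}u^j\binom{n+j-1}{n-r}\left(\sum_{k=0}^{\min(r,j)}\binom{z-j}{r-k}\,P_{jk}(X)\right),$$ where the sum on the left runs over all partitions $\mu$ of $n$.
   Context: A partition $\mu=(\mu_1,\ldots,\mu_l)$ is a finite weakly decreasing sequence of positive integers; $l(\mu)=l$ is its length, $|\mu|=\sum_i\mu_i$ its weight, $m_i(\mu)$ the number of parts equal to $i$, and $z_\mu=\prod_{i\ge1} i^{m_i(\mu)}m_i(\mu)!$ (a rational number, unrelated to the indeterminate $z$). The empty partition is the only partition of weight $0$. For an integer $r\ge 0$, $\left\langle {\mu\atop r}\right\rangle$ is the number of ways to choose $r$ points in the Ferrers diagram $\{(i,j):1\le i\le l(\mu),\,1\le j\le\mu_i\}$ so that at least one point is chosen in each row. Thus $\left\langle {\mu\atop r}\right\rangle=0$ if $r<l(\mu)$ or $r>|\mu|$. $(x)_n=x(x+1)\cdots(x+n-1)$ is the rising factorial, and $\binom{x}{n}=\frac{x(x-1)\cdots(x-n+1)}{n!}$ for an integer $n\ge 0$ and any $x$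 (a polynomial in $x$); $\binom{x}{n}=0$ for $n<0$. For integers $j,k\ge 0$, $$P_{jk}(X)=\sum_{|\mu|=j}\frac{\left\langle {\mu\atop k}\right\rangle}{z_\mu}\prod_{i\ge1}X_i^{m_i(\mu)},$$ with $P_{00}(X)=1$. In particular $P_{j0}(X)=0$ for $j\ge1$, and $P_{jk}(X)=0$ for $k>j$. *)

theory Defs
  imports Complex_Main "HOL-Library.Poly_Mapping"
    "HOL-Computational_Algebra.Formal_Power_Series"
begin

subsection \<open>Partitions\<close>

definition partitions :: "nat \<Rightarrow> nat list set" where
  "partitions n = {\<mu>. sorted_wrt (\<ge>) \<mu> \<and> (\<forall>p\<in>set \<mu>. 0 < p) \<and> sum_list \<mu> = n}"

text \<open>All sums over \<^term>\<open>partitions n\<close> are genuine finite sums.\<close>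

lemma finite_partitions: "finite (partitions n)"
proof (rule finite_subset)
  have len: "length \<mu> \<le> sum_list \<mu>" if "\<forall>p\<in>set \<mu>. 0 < p" for \<mu> :: "nat list"
    using that by (induction \<mu>) auto
  show "partitions n \<subseteq> {\<mu>. set \<mu> \<subseteq> {..n} \<and> length \<mu> \<le> n}"
    unfolding partitions_def using len member_le_sum_list by fastforce
  show "finite {\<mu> :: nat list. set \<mu> \<subseteq> {..n} \<and> length \<mu> \<le> n}"
    by (rule finite_lists_length_le) simp
qed

definition mpart :: "nat list \<Rightarrow> nat \<Rightarrow> nat" where
  "mpart \<mu> i = count_list \<mu> i"

text \<open>Products over all \<open>i \<ge> 1\<close> of factors with exponent \<^term>\<open>mpart \<mu> i\<close> are taken over the
  parts that occur, since all other factors are 1.\<close>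

definition zee :: "nat list \<Rightarrow> rat" where
  "zee \<mu> = (\<Prod>i\<in>set \<mu>. of_nat i ^ mpart \<mu> i * fact (mpart \<mu> i))"

definition ferrers :: "nat list \<Rightarrow> (nat \<times> nat) set" where
  "ferrers \<mu> = {(i, j). 1 \<le> i \<and> i \<le> length \<mu> \<and> 1 \<le> j \<and> j \<le> \<mu> ! (i - 1)}"

definition bracket :: "nat list \<Rightarrow> nat \<Rightarrow> nat" where
  "bracket \<mu> r = card {S. S \<subseteq> ferrers \<mu> \<and> card S = r \<and>
                          (\<forall>i\<in>{1..length \<mu>}. \<exists>j. (i, j) \<in> S)}"

subsection \<open>The polynomial ring in \<open>z, X\<^sub>1, X\<^sub>2, \<dots>\<close> over the rationals\<close>

text \<open>A monomial is a finitely supported exponent function on the variable indices; index 0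
  stands for the indeterminate \<open>z\<close> and index \<open>i \<ge> 1\<close> for \<open>X\<^sub>i\<close>.\<close>

type_synonym qpoly = "(nat \<Rightarrow>\<^sub>0 nat) \<Rightarrow>\<^sub>0 rat"

definition scal :: "rat \<Rightarrow> qpoly" where
  "scal c = Poly_Mapping.single 0 c"

definition indet :: "nat \<Rightarrow> qpoly" where
  "indet i = Poly_Mapping.single (Poly_Mapping.single i 1) 1"

abbreviation var_z :: qpoly where
  "var_z \<equiv> indet 0"

abbreviation var_X :: "nat \<Rightarrow> qpoly" where
  "var_X i \<equiv> indet i"

text \<open>The library's \<^const>\<open>gbinomial\<close> needs division in the ring, which \<^typ>\<open>qpoly\<close> lacks.\<close>

definition binom :: "qpoly \<Rightarrow> int \<Rightarrow> qpoly" where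
  "binom x n = (if n < 0 then 0
                else scal (1 / fact (nat n)) * (\<Prod>i<nat n. x - of_nat i))"

definition Pjk :: "nat \<Rightarrow> nat \<Rightarrow> qpoly" where
  "Pjk j k = (\<Sum>\<mu>\<in>partitions j.
              scal (of_nat (bracket \<mu> k) / zee \<mu>) * (\<Prod>i\<in>set \<mu>. var_X i ^ mpart \<mu> i))"

text \<open>The power series \<open>z + (\<Sum>k\<ge>1. u\<^sup>k (i)\<^sub>k / k! X\<^sub>k)\<close> in \<open>u\<close>.\<close>

definition zser :: "nat \<Rightarrow> qpoly fps" where
  "zser i = fps_const var_z +
     Abs_fps (\<lambda>k. if k = 0 then 0 else scal (pochhammer (of_nat i) k / fact k) * var_X k)"

end

theory Submission
  imports Defs "HOL-Library.Multiset" "HOL-Library.FuncSet"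
begin

text \<open>
  The identity compares the coefficients of \<open>t\<^sup>n y\<^sup>r u\<^sup>j\<close> in two expansions of one generating
  function. Throughout, \<open>y\<close> is replaced by \<open>-y\<close> to absorb the sign \<open>(-1)\<^sup>r\<close>; put
  \<open>c = 1 + y\<close>, \<open>w = 1 / (1 - t)\<close>, \<open>v = 1 / (1 - c t)\<close>.

  Choosing a nonempty set of points in every row gives
  \<open>\<Sum>\<^sub>r bracket \<mu> r y\<^sup>r = \<Prod>\<^sub>i ((1 + y)^\<mu>\<^sub>i - 1)\<close> (lemma \<open>bracket_fps\<close>). Hence, writing \<open>A\<^sub>i\<close>
  for the series \<open>zser i\<close>, the left-hand sides for all \<open>n\<close> and \<open>r\<close> have the generating function
  \<open>L = exp (\<Sum>\<^sub>i (t\<^sup>i / i) (1 - c\<^sup>i) A\<^sub>i)\<close>. Summing over \<open>i\<close> in the exponent gives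
  \<open>L = (w / v)\<^sup>z exp (\<Sum>\<^sub>k (X\<^sub>k / k) ((u w)\<^sup>k - (u v)\<^sup>k))\<close>.
  With \<open>1 + s = w / v\<close>, that is \<open>s = - y t / (1 - t)\<close>, the same lemma identifies the second factor as
  \<open>\<Sum>\<^sub>j (u v)\<^sup>j \<Sum>\<^sub>k P\<^sub>j\<^sub>k s\<^sup>k\<close>, so that the coefficient of \<open>u\<^sup>j\<close> in \<open>L\<close> is
  \<open>(1 + s)\<^sup>z v\<^sup>j \<Sum>\<^sub>k P\<^sub>j\<^sub>k s\<^sup>k = w\<^sup>j (1 + s)\<^bsup>z - j\<^esup> \<Sum>\<^sub>k P\<^sub>j\<^sub>k s\<^sup>k\<close>.
  Since \<open>s\<^sup>r\<close> is the only power of \<open>s\<close> containing \<open>y\<^sup>r\<close>, the coefficient of \<open>t\<^sup>n y\<^sup>r\<close> is read off from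
  \<open>w\<^bsup>r + j\<^esup> t\<^sup>r\<close>, and it is the right-hand side (lemma \<open>at_s_coeff\<close>).

  The proof replaces exponentials and logarithms, which need division in the coefficient ring, by
  logarithmic derivatives. A sum over partitions weighted by \<open>1 / z\<^sub>\<mu>\<close> is
  characterised by Newton's recursion (lemma \<open>partition_sum_newton\<close>). Differentiating with respect
  to \<open>t\<close> shows that the closed form satisfies the recursion that characterises the left-hand sides
  (lemmas \<open>at_s_binomial_deriv\<close>, \<open>newton_imp_deriv\<close> and \<open>deriv_expansion_coeff\<close>), and the
  coefficients agree because the ring has characteristic zero (lemma \<open>expansion_coeff_unique\<close>).
\<close>

unbundle fps_syntax

section \<open>Sums over partitions\<close>

lemma prod_set_mpart:
  "(\<Prod>i\<in>set \<mu>. f i ^ mpart \<mu> i) = prod_list (map (f :: nat \<Rightarrow> 'a::comm_monoid_mult) \<mu>)"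
proof -
  have "(\<Prod>i\<in>set \<mu>. f i ^ mpart \<mu> i) = (\<Prod>i\<in>set_mset (mset \<mu>). f i ^ count (mset \<mu>) i)"
    by (simp add: mpart_def count_mset)
  also have "\<dots> = prod_mset (image_mset f (mset \<mu>))"
    by (simp add: image_prod_mset_multiplicity)
  finally show ?thesis by (simp flip: mset_map prod_mset_prod_list)
qed

definition insert_part :: "nat \<Rightarrow> nat list \<Rightarrow> nat list" where
  "insert_part i \<nu> = rev (insort i (rev \<nu>))"

lemma sorted_ge_eqI:
  assumes "sorted_wrt (\<ge>) (xs :: nat list)" "sorted_wrt (\<ge>) ys" "mset xs = mset ys"
  shows "xs = ys"
proof -
  have "rev xs = rev ys"
    using assms by (metis mset_rev properties_for_sort sorted_wrt_rev sorted_sort_id)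
  then show ?thesis by simp
qed

lemma sorted_ge_remove1: "sorted_wrt (\<ge>) (xs :: nat list) \<Longrightarrow> sorted_wrt (\<ge>) (remove1 x xs)"
  by (induction xs) (auto dest: notin_set_remove1[rotated] intro: ccontr)

lemma mset_insert_part [simp]: "mset (insert_part i \<nu>) = add_mset i (mset \<nu>)"
  by (simp add: insert_part_def)

lemma insert_part_partitions:
  assumes "\<nu> \<in> partitions (n - i)" "1 \<le> i" "i \<le> n"
  shows "insert_part i \<nu> \<in> partitions n"
proof -
  have "sum_list (insert_part i \<nu>) = i + sum_list \<nu>"
    by (simp flip: sum_mset_sum_list)
  moreover have "set (insert_part i \<nu>) = insert i (set \<nu>)"
    by (simp flip: set_mset_mset)
  moreover have "sorted_wrt (\<ge>) (insert_part i \<nu>)"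
    using assms by (simp add: partitions_def insert_part_def sorted_wrt_rev sorted_insort)
  ultimately show ?thesis using assms by (auto simp: partitions_def)
qed

lemma remove1_partitions:
  assumes "\<mu> \<in> partitions n" "i \<in> set \<mu>"
  shows "1 \<le> i" "i \<le> n" "remove1 i \<mu> \<in> partitions (n - i)"
proof -
  have "sum_list \<mu> = i + sum_list (remove1 i \<mu>)"
    using assms by (simp add: sum_list_map_remove1[of i \<mu> id, simplified])
  then show "1 \<le> i" "i \<le> n" "remove1 i \<mu> \<in> partitions (n - i)"
    using assms by (auto simp: partitions_def sorted_ge_remove1 Suc_le_eq dest: notin_set_remove1[rotated] in_set_remove1)
qed

text \<open>
  For \<open>W \<mu> = 1 / z\<^sub>\<mu>\<close> this is Newton's identity between complete homogeneous symmetric functions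
  and power sums. It is a double count of pairs of a partition of \<open>n\<close> and one of its distinct
  parts: removing the part \<open>i\<close> multiplies \<open>z\<^sub>\<mu>\<close> by \<open>1 / (i m\<^sub>i(\<mu>))\<close>, and \<open>n\<close> is the sum of the
  numbers \<open>i m\<^sub>i(\<mu>)\<close>. Only this behaviour of the weight matters, so \<open>W\<close> may take values in any
  commutative ring.
\<close>

lemma partition_sum_newton:
  fixes p :: "nat \<Rightarrow> 'a::comm_ring_1" and W :: "nat list \<Rightarrow> 'a"
  assumes W: "\<And>\<mu> i n. \<mu> \<in> partitions n \<Longrightarrow> i \<in> set \<mu> \<Longrightarrow> of_nat (i * mpart \<mu> i) * W \<mu> = W (remove1 i \<mu>)"
  defines "H \<equiv> \<lambda>n. \<Sum>\<mu>\<in>partitions n. W \<mu> * prod_list (map p \<mu>)"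
  shows "of_nat n * H n = (\<Sum>i=1..n. p i * H (n - i))"
proof -
  have "of_nat n * H n = (\<Sum>\<mu>\<in>partitions n. of_nat n * W \<mu> * prod_list (map p \<mu>))"
    by (simp add: H_def sum_distrib_left mult.assoc)
  also have "\<dots> = (\<Sum>\<mu>\<in>partitions n. \<Sum>i\<in>set \<mu>. p i * (W (remove1 i \<mu>) * prod_list (map p (remove1 i \<mu>))))"
  proof (rule sum.cong[OF refl])
    fix \<mu> assume mu: "\<mu> \<in> partitions n"
    have "n = sum_list (map id \<mu>)" using mu by (simp add: partitions_def)
    also have "\<dots> = (\<Sum>i\<in>set \<mu>. i * mpart \<mu> i)"
      by (subst sum_list_map_eq_sum_count) (simp add: mpart_def mult.commute)
    finally have n: "(of_nat n :: 'a) = (\<Sum>i\<in>set \<mu>. of_nat (i * mpart \<mu> i))"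
      by (metis of_nat_sum)
    have mon: "prod_list (map p \<mu>) = p i * prod_list (map p (remove1 i \<mu>))" if "i \<in> set \<mu>" for i
      using that by (induction \<mu>) (auto simp: ac_simps)
    have "of_nat n * W \<mu> * prod_list (map p \<mu>) =
        (\<Sum>i\<in>set \<mu>. (of_nat (i * mpart \<mu> i) * W \<mu>) * prod_list (map p \<mu>))"
      unfolding n by (simp only: sum_distrib_right)
    also have "\<dots> = (\<Sum>i\<in>set \<mu>. p i * (W (remove1 i \<mu>) * prod_list (map p (remove1 i \<mu>))))"
      using W[OF mu] by (intro sum.cong refl) (simp add: mon ac_simps)
    finally show "of_nat n * W \<mu> * prod_list (map p \<mu>) = \<dots>" .
  qed
  also have "\<dots> = (\<Sum>(\<mu>, i)\<in>Sigma (partitions n) set.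
      p i * (W (remove1 i \<mu>) * prod_list (map p (remove1 i \<mu>))))"
    by (rule sum.Sigma) (auto simp: finite_partitions)
  also have "\<dots> = (\<Sum>(i, \<nu>)\<in>Sigma {1..n} (\<lambda>i. partitions (n - i)).
      p i * (W \<nu> * prod_list (map p \<nu>)))"
  proof (rule sum.reindex_bij_witness[where i = "\<lambda>(i, \<nu>). (insert_part i \<nu>, i)"
        and j = "\<lambda>(\<mu>, i). (i, remove1 i \<mu>)"], goal_cases)
    case (1 a)
    then show ?case
      by (auto simp: partitions_def insert_part_def sorted_wrt_rev sorted_insort
          intro!: sorted_ge_eqI sorted_ge_remove1)
  next
    case (2 a)
    then show ?case using remove1_partitions by fastforce
  next
    case (3 b)
    obtain i \<nu> where b: "b = (i, \<nu>)" by fastforce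
    have "insert_part i \<nu> \<in> partitions n" 
      using 3 insert_part_partitions by (auto simp: b)
    then have "remove1 i (insert_part i \<nu>) = \<nu>"
      using 3 by (intro sorted_ge_eqI sorted_ge_remove1) (auto simp: partitions_def b)
    then show ?case by (simp add: b)
  next
    case (4 b)
    obtain i \<nu> where b: "b = (i, \<nu>)" by fastforce
    have "i \<in> set (insert_part i \<nu>)" by (simp flip: set_mset_mset)
    then show ?case using 4 insert_part_partitions by (auto simp: b)
  qed auto
  also have "\<dots> = (\<Sum>i=1..n. \<Sum>\<nu>\<in>partitions (n - i). p i * (W \<nu> * prod_list (map p \<nu>)))"
    by (rule sum.Sigma[symmetric]) (auto simp: finite_partitions)
  finally show ?thesis by (simp add: H_def sum_distrib_left)
qed

lemma partitions_0: "partitions 0 = {[]}"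
  by (auto simp: partitions_def) (metis less_not_refl list.set_intros(1) neq_Nil_conv)

lemma zee_nonzero: "\<mu> \<in> partitions n \<Longrightarrow> zee \<mu> \<noteq> 0"
  by (auto simp: zee_def partitions_def)

lemma zee_remove1:
  assumes "\<mu> \<in> partitions n" "i \<in> set \<mu>"
  shows "of_nat (i * mpart \<mu> i) * (1 / zee \<mu>) = 1 / zee (remove1 i \<mu>)"
proof -
  let ?f = "\<lambda>\<mu> j. of_nat j ^ mpart \<mu> j * fact (mpart \<mu> j) :: rat"
  let ?\<nu> = "remove1 i \<mu>"
  have i: "i > 0" using assms by (auto simp: partitions_def)
  have m: "mpart \<mu> i = Suc (mpart ?\<nu> i)"
    using assms by (induction \<mu> arbitrary: n) (auto simp: mpart_def partitions_def count_list_0_iff)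
  have mj: "mpart ?\<nu> j = mpart \<mu> j" if "j \<noteq> i" for j
    using that by (induction \<mu>) (auto simp: mpart_def)
  have m0: "mpart ?\<nu> j = 0" if "j \<notin> set ?\<nu>" for j
    using that unfolding mpart_def by (rule count_notin)
  have "zee ?\<nu> = (\<Prod>j\<in>set \<mu>. ?f ?\<nu> j)"
    unfolding zee_def 
    using set_remove1_subset[of i \<mu>] by (intro prod.mono_neutral_left) (auto simp: m0)
  also have "\<dots> = ?f ?\<nu> i * (\<Prod>j\<in>set \<mu> - {i}. ?f \<mu> j)"
    using assms by (subst prod.remove[of _ i]) (auto simp: mj)
  finally have "of_nat (i * mpart \<mu> i) * zee ?\<nu> = ?f \<mu> i * (\<Prod>j\<in>set \<mu> - {i}. ?f \<mu> j)"
    by (simp add: m algebra_simps)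
  also have "\<dots> = zee \<mu>"
    unfolding zee_def using assms by (subst (2) prod.remove[of _ i]) auto
  finally show ?thesis
    using zee_nonzero[OF assms(1)] zee_nonzero[OF remove1_partitions(3)[OF assms]] i
    by (auto simp: field_simps)
qed

section \<open>Generating function of the row-covering choices\<close>

lemma ferrers_Sigma: "ferrers \<mu> = Sigma {1..length \<mu>} (\<lambda>i. {1..\<mu> ! (i - 1)})"
  by (auto simp: ferrers_def)

lemma finite_ferrers: "finite (ferrers \<mu>)"
  by (simp add: ferrers_Sigma)

lemma card_ferrers: "card (ferrers \<mu>) = sum_list \<mu>"
proof -
  have "card (ferrers \<mu>) = (\<Sum>i=1..length \<mu>. \<mu> ! (i - 1))"
    by (simp add: ferrers_Sigma)
  also have "\<dots> = (\<Sum>i<length \<mu>. \<mu> ! i)"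
    by (rule sum.reindex_bij_witness[of _ Suc "\<lambda>i. i - 1"]) auto
  finally show ?thesis
    by (simp add: sum_list_sum_nth atLeast0LessThan)
qed

lemma bracket_eq_0:
  assumes "sum_list \<mu> < r"
  shows "bracket \<mu> r = 0"
proof -
  have "card S \<noteq> r" if "S \<subseteq> ferrers \<mu>" for S
    using card_mono[OF finite_ferrers that] assms by (simp add: card_ferrers)
  then have "{S. S \<subseteq> ferrers \<mu> \<and> card S = r \<and> (\<forall>i\<in>{1..length \<mu>}. \<exists>j. (i, j) \<in> S)} = {}"
    by auto
  then show ?thesis unfolding bracket_def by (simp only: card.empty)
qed

lemma sum_Pow_power_card:
  fixes x :: "'a::comm_ring_1"
  assumes "finite A"
  shows "(\<Sum>T\<in>Pow A. x ^ card T) = (1 + x) ^ card A"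
  using assms prod_add[OF assms, of "\<lambda>_. x" "\<lambda>_. 1"] by (simp add: add.commute)

text \<open>
  A set of points that meets every row is a family of nonempty subsets of the rows, and
  the nonempty subsets of a row of length \<open>m\<close>, counted by size, contribute \<open>(1 + X)\<^sup>m - 1\<close>.
\<close>

lemma bracket_fps:
  "Abs_fps (\<lambda>r. of_nat (bracket \<mu> r)) =
     prod_list (map (\<lambda>m. (1 + fps_X) ^ m - 1 :: 'a::comm_ring_1 fps) \<mu>)"
proof -
  define I where "I = {1..length \<mu>}"
  define R where "R = (\<lambda>i. {1..\<mu> ! (i - 1)})"
  define V where "V = {S. S \<subseteq> ferrers \<mu> \<and> (\<forall>i\<in>I. \<exists>j. (i, j) \<in> S)}"
  define P where "P = PiE I (\<lambda>i. Pow (R i) - {{}})"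
  have fin: "finite V"
    by (rule finite_subset[of _ "Pow (ferrers \<mu>)"]) (auto simp: V_def finite_ferrers)
  have "Abs_fps (\<lambda>r. of_nat (bracket \<mu> r)) = (\<Sum>S\<in>V. fps_X ^ card S :: 'a fps)"
  proof (rule fps_ext)
    fix r
    have "(\<Sum>S\<in>V. fps_X ^ card S :: 'a fps) $ r = (\<Sum>S\<in>V. if card S = r then 1 else 0)"
      by (simp add: fps_sum_nth fps_X_power_nth eq_commute)
    also have "\<dots> = of_nat (card (V \<inter> {S. card S = r}))"
      using fin by (simp add: sum.If_cases)
    also have "V \<inter> {S. card S = r} = {S. S \<subseteq> ferrers \<mu> \<and> card S = r \<and> (\<forall>i\<in>{1..length \<mu>}. \<exists>j. (i, j) \<in> S)}"
      by (auto simp: V_def I_def)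
    finally show "Abs_fps (\<lambda>r. of_nat (bracket \<mu> r)) $ r = (\<Sum>S\<in>V. fps_X ^ card S :: 'a fps) $ r"
      by (simp add: bracket_def)
  qed
  also have "\<dots> = (\<Sum>f\<in>P. fps_X ^ card (Sigma I f))"
  proof (rule sum.reindex_bij_witness[where i = "Sigma I" and j = "\<lambda>S. \<lambda>i\<in>I. {j. (i, j) \<in> S}"], goal_cases)
    case (1 S)
    then show ?case by (auto simp: V_def ferrers_def I_def)
  next
    case (2 S)
    then show ?case by (auto simp: V_def P_def R_def ferrers_def I_def)
  next
    case (3 f)
    then show ?case by (auto simp: P_def PiE_def extensional_def fun_eq_iff)
  next
    case (4 f)
    then show ?case by (fastforce simp: V_def P_def R_def ferrers_def I_def PiE_def Pi_def)
  next
    case (5 S)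
    then have "Sigma I (\<lambda>i\<in>I. {j. (i, j) \<in> S}) = S" by (auto simp: V_def ferrers_def I_def)
    then show ?case by simp
  qed
  also have "\<dots> = (\<Sum>f\<in>P. \<Prod>i\<in>I. fps_X ^ card (f i))"
  proof (rule sum.cong[OF refl])
    fix f assume "f \<in> P"
    then have "finite (f i)" if "i \<in> I" for i
      using that finite_subset[of "f i" "R i"] by (auto simp: P_def PiE_def Pi_def R_def)
    then show "(fps_X ^ card (Sigma I f) :: 'a fps) = (\<Prod>i\<in>I. fps_X ^ card (f i))"
      by (subst card_SigmaI) (auto simp: I_def power_sum)
  qed
  also have "\<dots> = (\<Prod>i\<in>I. \<Sum>T\<in>Pow (R i) - {{}}. fps_X ^ card T)"
    unfolding P_def by (rule prod_sum_PiE[symmetric]) (auto simp: I_def R_def)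
  also have "\<dots> = (\<Prod>i\<in>I. (1 + fps_X) ^ (\<mu> ! (i - 1)) - 1)"
  proof (rule prod.cong[OF refl])
    fix i
    have "(\<Sum>T\<in>Pow (R i). fps_X ^ card T :: 'a fps) = (1 + fps_X) ^ (\<mu> ! (i - 1))"
      by (subst sum_Pow_power_card) (auto simp: R_def)
    then show "(\<Sum>T\<in>Pow (R i) - {{}}. fps_X ^ card T :: 'a fps) = (1 + fps_X) ^ (\<mu> ! (i - 1)) - 1"
      by (subst sum_diff1) (auto simp: R_def)
  qed
  also have "\<dots> = (\<Prod>i<length \<mu>. (1 + fps_X) ^ (\<mu> ! i) - 1)"
    unfolding I_def by (rule prod.reindex_bij_witness[of _ Suc "\<lambda>i. i - 1"]) auto
  also have "\<dots> = prod_list (map (\<lambda>m. (1 + fps_X) ^ m - 1) \<mu>)"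
    by (simp add: prod.list_conv_set_nth atLeast0LessThan)
  finally show ?thesis .
qed

section \<open>Binomial series over the polynomial ring\<close>

lemma scal_mult: "scal (a * b) = scal a * scal b"
  by (simp add: scal_def mult_single)

lemma scal_of_nat [simp]: "scal (of_nat n) = of_nat n"
  by (simp add: scal_def)

lemma scal_of_int [simp]: "scal (of_int n) = of_int n"
  by (simp add: scal_def)

lemma scal_1 [simp]: "scal 1 = 1"
  using scal_of_nat[of 1] by simp

lemma binom_0 [simp]: "binom x 0 = 1"
  by (simp add: binom_def)

lemma binom_neg [simp]: "n < 0 \<Longrightarrow> binom x n = 0"
  by (simp add: binom_def)

lemma fact_binom: "fact m * binom x (int m) = (\<Prod>i<m. x - of_nat i)"
proof -
  have "scal (fact m) = fact m"
    by (metis of_nat_fact scal_of_nat)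
  then have "fact m * scal (1 / fact m) = 1"
    using scal_mult[of "fact m" "1 / fact m"] by simp
  then show ?thesis by (simp add: binom_def flip: mult.assoc)
qed

lemma qpoly_cancel_fact:
  assumes "fact m * x = fact m * (y :: qpoly)"
  shows "x = y"
proof -
  have "(of_nat (fact m) :: qpoly) \<noteq> 0" by (subst of_nat_eq_0_iff) simp
  then show ?thesis using assms by simp
qed

lemma binom_Suc: "of_nat (Suc m) * binom x (1 + int m) = (x - of_nat m) * binom x (int m)"
proof (rule qpoly_cancel_fact[of m])
  have "fact m * (of_nat (Suc m) * binom x (1 + int m)) = fact (Suc m) * binom x (int (Suc m))"
    by (simp add: algebra_simps)
  also have "\<dots> = (x - of_nat m) * (\<Prod>i<m. x - of_nat i)"
    unfolding fact_binom by simp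
  finally show "fact m * (of_nat (Suc m) * binom x (1 + int m)) = fact m * ((x - of_nat m) * binom x (int m))"
    by (simp flip: fact_binom)
qed

text \<open>
  Here the falling product is split off at its first factor instead of its last; comparing with
  lemma \<open>binom_Suc\<close> gives Pascal's rule without division in the ring.
\<close>

lemma binom_Suc': "of_nat (Suc m) * binom (x + 1) (1 + int m) = (x + 1) * binom x (int m)"
proof (rule qpoly_cancel_fact[of m])
  have "fact m * (of_nat (Suc m) * binom (x + 1) (1 + int m)) = fact (Suc m) * binom (x + 1) (int (Suc m))"
    by (simp add: algebra_simps)
  also have "\<dots> = (x + 1) * (\<Prod>i<m. x - of_nat i)"
    unfolding fact_binom prod.lessThan_Suc_shift by simp
  finally show "fact m * (of_nat (Suc m) * binom (x + 1) (1 + int m)) = fact m * ((x + 1) * binom x (int m))"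
    by (simp flip: fact_binom)
qed

lemma binom_of_nat: "binom (of_nat a) (int m) = of_nat (a choose m)"
proof (induction m)
  case (Suc m)
  have "of_nat (Suc m) * binom (of_nat a) (int (Suc m)) = of_nat (Suc m) * of_nat (a choose Suc m)"
  proof (cases "m \<le> a")
    case True
    have "Suc m * (a choose Suc m) = (a - m) * (a choose m)"
      by (metis binomial_absorb_comp binomial_absorption mult.commute Suc_times_binomial_eq)
    then have "of_nat (Suc m) * of_nat (a choose Suc m) = (of_nat a - of_nat m) * (of_nat (a choose m) :: qpoly)"
      using True by (metis of_nat_diff of_nat_mult)
    then show ?thesis using binom_Suc[of m "of_nat a"] Suc.IH by simp
  next
    case False
    then show ?thesis using binom_Suc[of m "of_nat a"] Suc.IH by (simp add: binomial_eq_0)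
  qed
  then show ?case by (simp only: mult_cancel_left) (metis of_nat_neq_0)
qed simp

definition binomial_series :: "qpoly \<Rightarrow> qpoly fps" where
  "binomial_series x = Abs_fps (\<lambda>m. binom x (int m))"

lemma binomial_series_deriv:
  "(1 + fps_X) * fps_deriv (binomial_series x) = fps_const x * binomial_series x"
proof (rule fps_ext)
  fix n
  show "((1 + fps_X) * fps_deriv (binomial_series x)) $ n = (fps_const x * binomial_series x) $ n"
    using binom_Suc[of n x] binom_Suc[of "n - 1" x]
    by (cases n) (simp_all add: binomial_series_def algebra_simps)
qed

lemma binomial_series_add_1:
  "binomial_series (x + 1) = (1 + fps_X) * binomial_series x"
proof (rule fps_ext)
  fix n
  show "binomial_series (x + 1) $ n = ((1 + fps_X) * binomial_series x) $ n"
  proof (cases n)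
    case (Suc m)
    have "of_nat (Suc m) * binom (x + 1) (1 + int m) =
        of_nat (Suc m) * (binom x (int m) + binom x (1 + int m))"
      using binom_Suc[of m x] binom_Suc'[of m x] by (simp add: algebra_simps)
    then have "binom (x + 1) (1 + int m) = binom x (int m) + binom x (1 + int m)"
      by (metis mult_cancel_left of_nat_neq_0)
    then show ?thesis by (simp add: Suc binomial_series_def algebra_simps)
  qed (simp add: binomial_series_def)
qed

lemma binomial_series_diff:
  "(1 + fps_X) ^ j * binomial_series (x - of_nat j) = binomial_series x"
proof (induction j)
  case (Suc j)
  have "(1 + fps_X) * binomial_series (x - of_nat (Suc j)) = binomial_series (x - of_nat j)"
    by (subst binomial_series_add_1[symmetric]) simp
  then have "(1 + fps_X) ^ Suc j * binomial_series (x - of_nat (Suc j)) =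
      (1 + fps_X) ^ j * binomial_series (x - of_nat j)"
    by (simp only: power_Suc2 mult.assoc)
  then show ?case by (simp only: Suc)
qed simp

section \<open>Auxiliary power series\<close>

text \<open>
  The inner of the two power series variables is \<open>y\<close>. The map \<open>lift_fps\<close> turns a series in one
  variable over the base ring into a series in the outer variable whose coefficients are constant
  in \<open>y\<close>.
\<close>

definition lift_fps :: "'a::zero fps \<Rightarrow> 'a fps fps" where
  "lift_fps f = Abs_fps (\<lambda>n. fps_const (f $ n))"

lemma lift_fps_nth [simp]: "lift_fps f $ n = fps_const (f $ n)"
  by (simp add: lift_fps_def)

lemma fps_const_sum: "fps_const (sum f A) = (\<Sum>x\<in>A. fps_const (f x :: 'a::comm_monoid_add))"
  by (rule fps_ext) (auto simp: fps_sum_nth)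

lemma lift_fps_mult: "lift_fps (f * g) = lift_fps f * lift_fps (g :: 'a::comm_ring_1 fps)"
  by (rule fps_ext) (simp add: fps_mult_nth fps_const_sum)

lemma lift_fps_1 [simp]: "lift_fps 1 = (1 :: 'a::comm_ring_1 fps fps)"
  by (rule fps_ext) simp

lemma lift_fps_const: "lift_fps (fps_const a) = fps_const (fps_const (a :: 'a::comm_ring_1))"
  by (rule fps_ext) simp

lemma lift_fps_add: "lift_fps (f + g) = lift_fps f + lift_fps (g :: 'a::comm_ring_1 fps)"
  by (rule fps_ext) simp

lemma lift_fps_diff: "lift_fps (f - g) = lift_fps f - lift_fps (g :: 'a::comm_ring_1 fps)"
  by (rule fps_ext) simp

lemma lift_fps_sum: "lift_fps (sum f A) = (\<Sum>x\<in>A. lift_fps (f x :: 'a::comm_ring_1 fps))"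
  by (rule fps_ext) (simp add: fps_sum_nth fps_const_sum)

lemma lift_fps_X [simp]: "lift_fps fps_X = (fps_X :: 'a::comm_ring_1 fps fps)"
  by (rule fps_ext) simp

lemma lift_fps_power: "lift_fps (f ^ n) = lift_fps (f :: 'a::comm_ring_1 fps) ^ n"
  by (induction n) (simp_all add: lift_fps_mult)

lemma lift_fps_prod_list:
  "lift_fps (prod_list xs) = prod_list (map lift_fps (xs :: 'a::comm_ring_1 fps list))"
  by (induction xs) (simp_all add: lift_fps_mult)

lemma lift_fps_deriv: "fps_deriv (lift_fps f) = lift_fps (fps_deriv (f :: 'a::comm_ring_1 fps))"
  by (rule fps_ext) (simp flip: fps_of_nat)

text \<open>
  The series \<open>w\<close> and \<open>v\<close> are \<open>geo 1\<close> and \<open>geo (1 + y)\<close>.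
\<close>

definition geo :: "'a::comm_ring_1 \<Rightarrow> 'a fps" where
  "geo c = Abs_fps (\<lambda>n. c ^ n)"

lemma geo_inverse: "(1 - fps_const c * fps_X) * geo c = 1"
proof (rule fps_ext)
  fix n show "((1 - fps_const c * fps_X) * geo c) $ n = 1 $ n"
    by (cases n) (simp_all add: geo_def algebra_simps mult.assoc)
qed

lemma geo_power_nth: "(geo c ^ Suc k) $ n = of_nat ((n + k) choose k) * c ^ n"
proof (induction k arbitrary: n)
  case 0
  show ?case by (simp add: geo_def)
next
  case (Suc k)
  have step: "geo c ^ Suc (Suc k) = geo c ^ Suc k + fps_X * (fps_const c * geo c ^ Suc (Suc k))"
  proof -
    have "geo c ^ Suc k = ((1 - fps_const c * fps_X) * geo c) * geo c ^ Suc k"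
      by (simp add: geo_inverse)
    then show ?thesis by (simp add: algebra_simps)
  qed
  show ?case
  proof (induction n)
    case 0
    show ?case by (subst step) (simp add: Suc.IH del: power_Suc)
  next
    case (Suc n)
    have "geo c ^ Suc (Suc k) $ Suc n = geo c ^ Suc k $ Suc n + c * (geo c ^ Suc (Suc k) $ n)"
      by (subst step) (simp del: power_Suc)
    then show ?case using Suc.IH 
      by (simp add: \<open>\<And>n. (geo c ^ Suc k) $ n = of_nat ((n + k) choose k) * c ^ n\<close> algebra_simps del: power_Suc)
         (simp add: algebra_simps)
  qed
qed

lemma geo_deriv: "fps_deriv (geo c) = fps_const c * geo c ^ 2"
proof -
  have "fps_deriv ((1 - fps_const c * fps_X) * geo c) = 0"
    by (simp add: geo_inverse)
  then have "(1 - fps_const c * fps_X) * fps_deriv (geo c) = fps_const c * geo c"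
    by (simp add: algebra_simps)
  then have "geo c * ((1 - fps_const c * fps_X) * fps_deriv (geo c)) = geo c * (fps_const c * geo c)"
    by simp
  then have "((1 - fps_const c * fps_X) * geo c) * fps_deriv (geo c) = fps_const c * geo c ^ 2"
    by (simp only: ac_simps power2_eq_square)
  then show ?thesis by (simp add: geo_inverse)
qed

section \<open>Differential equations\<close>

lemma fps_deriv_of_nat_mult: "fps_deriv (of_nat n * f) = of_nat n * fps_deriv (f :: 'a::comm_ring_1 fps)"
  by (simp flip: fps_of_nat)

text \<open>
  Newton's recursion says that \<open>\<Sum>\<^sub>n H\<^sub>n u\<^sup>n = exp (\<Sum>\<^sub>i q\<^sub>i u\<^sup>i / i)\<close>, and the conclusion is the chain
  rule for this exponential, where \<open>e\<^sub>i\<close> is the derivative of \<open>q\<^sub>i / i\<close>. To avoid the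
  exponential, let \<open>\<theta> = u d/du\<close>, let \<open>D\<close> be the derivation acting on coefficients, and write \<open>Hs\<close>,
  \<open>Q\<close>, \<open>E\<close> for the series in \<open>u\<close>. The operators commute, \<open>\<theta> Hs = Q Hs\<close> and \<open>D Q = \<theta> E\<close>. Hence
  \<open>\<Delta> = D Hs - E Hs\<close> satisfies \<open>\<theta> \<Delta> = Q \<Delta>\<close> and has no constant term, which forces \<open>\<Delta> = 0\<close>.
\<close>

lemma newton_imp_deriv:
  fixes H q e :: "nat \<Rightarrow> 'a::{idom,semiring_char_0} fps"
  assumes H0: "H 0 = 1"
    and newton: "\<And>n. of_nat n * H n = (\<Sum>i=1..n. q i * H (n - i))"
    and deriv: "\<And>i. i \<ge> 1 \<Longrightarrow> fps_deriv (q i) = of_nat i * e i"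
  shows "fps_deriv (H n) = (\<Sum>i=1..n. e i * H (n - i))"
proof -
  define D where "D = (\<lambda>F :: 'a fps fps. Abs_fps (\<lambda>n. fps_deriv (F $ n)))"
  define Hs Q E where "Hs = Abs_fps H" and "Q = Abs_fps (\<lambda>i. if i = 0 then 0 else q i)"
    and "E = Abs_fps (\<lambda>i. if i = 0 then 0 else e i)"
  have mult0: "((Abs_fps (\<lambda>i. if i = 0 then 0 else p i)) * Hs) $ n = (\<Sum>i=1..n. p i * H (n - i))" for p n
    unfolding fps_mult_nth by (rule sum.mono_neutral_cong_right) (auto simp: Hs_def)
  have D_mult: "D (F * G) = D F * G + F * D G" for F G
    by (rule fps_ext) (simp add: D_def fps_mult_nth fps_deriv_sum sum.distrib)
  \<comment> \<open>\<open>\<theta>\<close> and \<open>D\<close> act on different variables, so they commute.\<close>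
  have D_theta: "D (fps_X * fps_deriv F) = fps_X * fps_deriv (D F)" for F
    by (rule fps_ext) (auto simp: D_def fps_deriv_of_nat_mult simp del: of_nat_Suc)
  have theta: "fps_X * fps_deriv Hs = Q * Hs"
  proof (rule fps_ext)
    fix n show "(fps_X * fps_deriv Hs) $ n = (Q * Hs) $ n"
      unfolding Q_def mult0 newton[symmetric] by (cases n) (simp_all add: Hs_def)
  qed
  have DQ: "D Q = fps_X * fps_deriv E"
  proof (rule fps_ext)
    fix n show "D Q $ n = (fps_X * fps_deriv E) $ n"
      by (cases n) (simp_all add: D_def Q_def E_def deriv del: of_nat_Suc)
  qed
  define \<Delta> where "\<Delta> = D Hs - E * Hs"
  have "fps_X * fps_deriv (D Hs) = fps_X * fps_deriv E * Hs + Q * D Hs"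
    using arg_cong[OF theta, of D] by (simp only: D_theta D_mult[of Q Hs] DQ)
  moreover have "fps_X * fps_deriv (E * Hs) = fps_X * fps_deriv E * Hs + E * (fps_X * fps_deriv Hs)"
    by (simp add: algebra_simps)
  ultimately have \<Delta>: "fps_X * fps_deriv \<Delta> = Q * \<Delta>"
    by (simp add: \<Delta>_def theta algebra_simps)
  have "\<Delta> $ m = 0" for m
  proof (induction m rule: less_induct)
    case (less m)
    show ?case
    proof (cases "m = 0")
      case True
      then show ?thesis by (simp add: \<Delta>_def D_def Hs_def E_def H0)
    next
      case False
      have "of_nat m * \<Delta> $ m = (Q * \<Delta>) $ m"
        using False by (cases m) (simp_all flip: \<Delta>)
      also have "\<dots> = 0"
        unfolding fps_mult_nth using less False by (intro sum.neutral) (auto simp: Q_def)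
      finally show ?thesis using False by simp
    qed
  qed
  then have "D Hs $ n = (E * Hs) $ n" by (simp add: \<Delta>_def)
  then show ?thesis unfolding E_def mult0 by (simp add: D_def Hs_def)
qed

abbreviation const2 :: "'a::comm_ring_1 \<Rightarrow> 'a fps fps" where
  "const2 a \<equiv> fps_const (fps_const a)"

definition one_plus_y :: "'a::comm_ring_1 fps" where "one_plus_y = 1 + fps_X"

text \<open>
  This is \<open>s = w / v - 1\<close>; the form \<open>s = - y t / (1 - t)\<close> of lemma \<open>subst_s_eq\<close> shows that
  substituting \<open>s\<close> is legitimate and that \<open>s\<^sup>i\<close> is homogeneous of degree \<open>i\<close> in \<open>y\<close>.
\<close>

definition subst_s :: "'a::comm_ring_1 fps fps" where
  "subst_s = (1 - fps_const one_plus_y * fps_X) * geo 1 - 1"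

lemma subst_s_eq: "subst_s = fps_const (- fps_X) * (fps_X * geo (1 :: 'a::comm_ring_1 fps))"
proof -
  have "(1 - fps_X) * geo 1 = (1 :: 'a fps fps)" using geo_inverse[of "1 :: 'a fps"] by simp
  then have "subst_s = (1 - fps_const one_plus_y * fps_X) * geo 1 - (1 - fps_X) * geo (1 :: 'a fps)"
    by (simp add: subst_s_def)
  also have "\<dots> = fps_const (1 - one_plus_y) * (fps_X * geo 1)"
    by (simp only: fps_const_sub[symmetric]) (simp add: algebra_simps)
  finally show ?thesis by (simp add: one_plus_y_def)
qed

lemma subst_s_0 [simp]: "subst_s $ 0 = 0"
  by (simp add: subst_s_eq)

lemma geo_subst_s: "geo one_plus_y * (1 + subst_s) = geo 1"
proof -
  have "geo one_plus_y * (1 + subst_s) = ((1 - fps_const one_plus_y * fps_X) * geo one_plus_y) * geo (1 :: 'a fps)"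
    by (simp add: subst_s_def ac_simps)
  then show ?thesis by (simp add: geo_inverse)
qed

abbreviation at_s :: "'a::comm_ring_1 fps \<Rightarrow> 'a fps fps" where
  "at_s f \<equiv> lift_fps f oo subst_s"

lemma at_s_mult: "at_s (f * g) = at_s f * at_s (g :: 'a::idom fps)"
  by (simp add: lift_fps_mult fps_compose_mult_distrib)

lemma at_s_add: "at_s (f + g) = at_s f + at_s (g :: 'a::idom fps)"
  by (simp add: lift_fps_add fps_compose_add_distrib)

lemma at_s_diff: "at_s (f - g) = at_s f - at_s (g :: 'a::idom fps)"
  by (simp add: lift_fps_diff fps_compose_sub_distrib)

lemma at_s_sum: "at_s (sum f A) = (\<Sum>x\<in>A. at_s (f x :: 'a::idom fps))"
  by (simp add: lift_fps_sum fps_compose_sum_distrib)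

lemma at_s_power: "at_s (f ^ n) = at_s (f :: 'a::idom fps) ^ n"
  by (simp add: lift_fps_power fps_compose_power)

lemma at_s_X: "at_s fps_X = (subst_s :: 'a::idom fps fps)"
  by simp

lemma at_s_const: "at_s (fps_const a) = const2 (a :: 'a::idom)"
  by (simp add: lift_fps_const)

lemma at_s_of_nat: "at_s (of_nat n) = (of_nat n :: 'a::idom fps fps)"
  using at_s_const[of "of_nat n :: 'a"] by (simp add: fps_of_nat)

text \<open>
  For \<open>f = (1 + X)\<^sup>a\<close> the substituted series is \<open>(w / v)\<^sup>a\<close>, and
  \<open>w' / w - v' / v = w - c v\<close>.
\<close>

lemma at_s_binomial_deriv:
  fixes f :: "'a::{idom,semiring_char_0} fps"
  assumes "(1 + fps_X) * fps_deriv f = fps_const a * f"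
  shows "fps_deriv (at_s f) = const2 a * (geo 1 - fps_const one_plus_y * geo one_plus_y) * at_s f"
proof -
  let ?v = "geo one_plus_y :: 'a fps fps" and ?w = "geo 1 :: 'a fps fps" and ?c = "fps_const one_plus_y :: 'a fps fps"
  have eq: "(1 + subst_s) * at_s (fps_deriv f) = const2 a * at_s f"
    using arg_cong[OF assms, of at_s] by (simp only: at_s_mult at_s_add at_s_X at_s_const) simp
  have w1: "(1 - fps_X) * ?w = 1" using geo_inverse[of "1 :: 'a fps"] by simp
  have v1: "?v * (1 - ?c * fps_X) = 1" using geo_inverse[of "one_plus_y :: 'a fps"] by (simp add: mult.commute)
  have ds: "fps_deriv subst_s = (1 - ?c * fps_X) * ?w ^ 2 - ?c * ?w"
    using geo_deriv[of "1 :: 'a fps"] by (simp add: subst_s_def algebra_simps)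
  have "?v * (b * ?w ^ 2 - ?c * ?w) = (?v * b) * ?w ^ 2 - ?c * ?w * ?v" for b
    by (simp add: algebra_simps)
  then have "?v * fps_deriv subst_s = (?v * (1 - ?c * fps_X)) * ?w ^ 2 - ?c * ?w * ?v"
    unfolding ds .
  also have "\<dots> = ?w * (?w - ?c * ?v)"
    unfolding v1 by (simp add: power2_eq_square algebra_simps)
  finally have vds: "?v * fps_deriv subst_s = ?w * (?w - ?c * ?v)" .
  have "?w * fps_deriv (at_s f) = (?v * (1 + subst_s)) * (at_s (fps_deriv f) * fps_deriv subst_s)"
    by (simp add: geo_subst_s fps_compose_deriv lift_fps_deriv)
  also have "\<dots> = ((1 + subst_s) * at_s (fps_deriv f)) * (?v * fps_deriv subst_s)"
    by (simp only: ac_simps)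
  also have "\<dots> = ?w * (const2 a * (?w - ?c * ?v) * at_s f)"
    unfolding eq vds by (simp only: ac_simps)
  finally have "?w * fps_deriv (at_s f) = ?w * (const2 a * (?w - ?c * ?v) * at_s f)" .
  then have "((1 - fps_X) * ?w) * fps_deriv (at_s f) = ((1 - fps_X) * ?w) * (const2 a * (?w - ?c * ?v) * at_s f)"
    by (simp only: mult.assoc)
  then show ?thesis by (simp only: w1 mult_1)
qed

lemma geo_power_deriv:
  assumes "i \<ge> 1"
  shows "fps_deriv (geo c ^ i) = of_nat i * (fps_const c * geo c ^ Suc i)"
proof -
  have "fps_deriv (geo c ^ Suc m) = of_nat (Suc m) * (fps_const c * geo c ^ Suc (Suc m))" for m
    by (induction m) (simp_all add: geo_deriv power2_eq_square algebra_simps)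
  from this[of "i - 1"] show ?thesis using assms by simp
qed

text \<open>
  Here \<open>G j\<close> is the coefficient of \<open>u\<^sup>j\<close> in
  \<open>(w / v)\<^sup>a exp (\<Sum>\<^sub>k (x\<^sub>k / k) ((u w)\<^sup>k - (u v)\<^sup>k))\<close>, and \<open>\<Gamma> k\<close> that of \<open>u\<^sup>k\<close> in its logarithmic
  derivative with respect to \<open>t\<close>. After scaling by \<open>v\<^sup>j\<close>, the factors \<open>(1 + s)\<^sup>k - 1\<close> in the
  recursion of \<open>P\<close> become \<open>w\<^sup>k - v\<^sup>k\<close>, whose derivatives are known.
\<close>

lemma deriv_expansion_coeff:
  fixes x :: "nat \<Rightarrow> 'a::{idom,semiring_char_0}" and P :: "nat \<Rightarrow> 'a fps" and f :: "'a fps"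
  assumes P0: "P 0 = 1"
    and P: "\<And>j. of_nat j * P j = (\<Sum>k=1..j. fps_const (x k) * ((1 + fps_X) ^ k - 1) * P (j - k))"
    and f: "(1 + fps_X) * fps_deriv f = fps_const a * f"
  defines "G \<equiv> \<lambda>j. at_s f * (geo one_plus_y ^ j * at_s (P j))"
    and "\<Gamma> \<equiv> \<lambda>k. if k = 0 then const2 a * (geo 1 - fps_const one_plus_y * geo one_plus_y)
               else const2 (x k) * (geo 1 ^ Suc k - fps_const one_plus_y * geo one_plus_y ^ Suc k)"
  shows "fps_deriv (G j) = (\<Sum>k=0..j. \<Gamma> k * G (j - k))"
proof -
  let ?v = "geo one_plus_y :: 'a fps fps" and ?w = "geo 1 :: 'a fps fps"
  define H where "H = (\<lambda>j. ?v ^ j * at_s (P j))"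
  have dH: "fps_deriv (H j) = (\<Sum>k=1..j. (const2 (x k) * (?w ^ Suc k - fps_const one_plus_y * ?v ^ Suc k)) * H (j - k))" for j
  proof (rule newton_imp_deriv[where q = "\<lambda>k. const2 (x k) * (?w ^ k - ?v ^ k)"])
    show "H 0 = 1" by (simp add: H_def P0)
  next
    fix j
    have "of_nat j * at_s (P j) = (\<Sum>k=1..j. const2 (x k) * ((1 + subst_s) ^ k - 1) * at_s (P (j - k)))"
      using arg_cong[OF P[of j], of at_s]
      by (simp only: at_s_mult at_s_add at_s_X at_s_const at_s_sum at_s_of_nat at_s_diff at_s_power) simp
    then have "?v ^ j * (of_nat j * at_s (P j)) = (\<Sum>k=1..j. ?v ^ j * (const2 (x k) * ((1 + subst_s) ^ k - 1) * at_s (P (j - k))))"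
      by (simp only: sum_distrib_left)
    also have "\<dots> = (\<Sum>k=1..j. (const2 (x k) * (?w ^ k - ?v ^ k)) * H (j - k))"
    proof (rule sum.cong[OF refl])
      fix k assume k: "k \<in> {1..j}"
      then have vj: "?v ^ j = ?v ^ k * ?v ^ (j - k)" by (simp flip: power_add)
      have "?w ^ k = ?v ^ k * (1 + subst_s) ^ k"
        by (simp only: geo_subst_s flip: power_mult_distrib)
      then show "?v ^ j * (const2 (x k) * ((1 + subst_s) ^ k - 1) * at_s (P (j - k))) =
          (const2 (x k) * (?w ^ k - ?v ^ k)) * H (j - k)"
        unfolding vj H_def by (simp add: algebra_simps)
    qed
    also have "?v ^ j * (of_nat j * at_s (P j)) = of_nat j * H j"
      by (simp only: H_def ac_simps)
    finally show "of_nat j * H j = (\<Sum>k=1..j. (const2 (x k) * (?w ^ k - ?v ^ k)) * H (j - k))" .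
  next
    fix i :: nat assume i: "i \<ge> 1"
    have "fps_deriv (const2 (x i) * (?w ^ i - ?v ^ i)) = const2 (x i) * (fps_deriv (?w ^ i) - fps_deriv (?v ^ i))"
      by simp
    also have "\<dots> = of_nat i * (const2 (x i) * (?w ^ Suc i - fps_const one_plus_y * ?v ^ Suc i))"
      unfolding geo_power_deriv[OF i] by (simp add: algebra_simps)
    finally show "fps_deriv (const2 (x i) * (?w ^ i - ?v ^ i)) =
        of_nat i * (const2 (x i) * (?w ^ Suc i - fps_const one_plus_y * ?v ^ Suc i))" .
  qed
  have "(\<Sum>k=0..j. \<Gamma> k * G (j - k)) = \<Gamma> 0 * G j + (\<Sum>k=1..j. \<Gamma> k * G (j - k))"
    by (simp add: sum.atLeast_Suc_atMost)
  also have "(\<Sum>k=1..j. \<Gamma> k * G (j - k)) =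
      at_s f * (\<Sum>k=1..j. (const2 (x k) * (?w ^ Suc k - fps_const one_plus_y * ?v ^ Suc k)) * H (j - k))"
    unfolding sum_distrib_left by (rule sum.cong) (auto simp: G_def \<Gamma>_def H_def ac_simps)
  also have "\<dots> = at_s f * fps_deriv (H j)" by (simp only: dH)
  also have "\<Gamma> 0 * G j = fps_deriv (at_s f) * H j"
    unfolding at_s_binomial_deriv[OF f] by (simp add: \<Gamma>_def G_def H_def ac_simps)
  finally show ?thesis by (simp add: G_def H_def)
qed

text \<open>
  \<open>L n\<close> is a series in \<open>u\<close> and \<open>G j\<close> a series in \<open>t\<close>. The coefficient of \<open>t\<^sup>i\<close> in \<open>\<Gamma> k\<close> is
  \<open>(1 - c\<^bsup>i + 1\<^esup>)\<close> times that of \<open>u\<^sup>k\<close> in \<open>A (i + 1)\<close>, so the differential equation of \<open>G\<close> and the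
  Newton recursion of \<open>L\<close> are the same recursion in \<open>n\<close> for the coefficients of \<open>t\<^sup>n u\<^sup>j\<close>.
\<close>

lemma expansion_coeff_unique:
  fixes x :: "nat \<Rightarrow> 'a::{idom,semiring_char_0}" and P A :: "nat \<Rightarrow> 'a fps" and f :: "'a fps"
    and L :: "nat \<Rightarrow> 'a fps fps"
  assumes P0: "P 0 = 1"
    and P: "\<And>j. of_nat j * P j = (\<Sum>k=1..j. fps_const (x k) * ((1 + fps_X) ^ k - 1) * P (j - k))"
    and f: "(1 + fps_X) * fps_deriv f = fps_const a * f" and f0: "f $ 0 = 1"
    and L0: "L 0 = 1"
    and L: "\<And>n. of_nat n * L n = (\<Sum>i=1..n. (lift_fps (A i) * fps_const (1 - one_plus_y ^ i)) * L (n - i))"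
    and A0: "\<And>i. A i $ 0 = a"
    and A: "\<And>i k. k \<ge> 1 \<Longrightarrow> A (Suc i) $ k = of_nat ((i + k) choose k) * x k"
  shows "L n $ j = (at_s f * (geo one_plus_y ^ j * at_s (P j))) $ n"
proof -
  define G where "G = (\<lambda>j. at_s f * (geo one_plus_y ^ j * at_s (P j)))"
  define \<Gamma> where "\<Gamma> = (\<lambda>k. if k = 0 then const2 a * (geo 1 - fps_const one_plus_y * geo one_plus_y)
               else const2 (x k) * (geo 1 ^ Suc k - fps_const one_plus_y * geo one_plus_y ^ Suc k))"
  have dG: "fps_deriv (G j) = (\<Sum>k=0..j. \<Gamma> k * G (j - k))" for j
    unfolding G_def \<Gamma>_def using deriv_expansion_coeff[OF P0 P f] .
  have \<Gamma>: "\<Gamma> k $ i = fps_const (A (Suc i) $ k) * (1 - one_plus_y ^ Suc i)" for k i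
  proof (cases "k = 0")
    case True
    then show ?thesis by (simp add: \<Gamma>_def A0 geo_def)
  next
    case False
    then show ?thesis
      by (simp add: \<Gamma>_def A geo_power_nth algebra_simps flip: fps_of_nat del: power_Suc)
         (simp add: algebra_simps)
  qed
  have AL: "(lift_fps (A i) * fps_const b * M) $ j = (\<Sum>k=0..j. fps_const (A i $ k) * b * M $ (j - k))"
    for i j b M
    by (subst fps_mult_nth) simp
  have Pj0: "P j $ 0 = (if j = 0 then 1 else 0)" for j
  proof (cases "j = 0")
    case False
    have "of_nat j * P j $ 0 = (of_nat j * P j) $ 0" by (simp flip: fps_of_nat)
    also have "\<dots> = 0" unfolding P by (simp add: fps_sum_nth fps_nth_power_0)
    finally show ?thesis using False by simp
  qed (simp add: P0)
  have "\<forall>j. L n $ j = G j $ n"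
  proof (induction n rule: less_induct)
    case (less n)
    show ?case
    proof (cases n)
      case 0
      then show ?thesis by (simp add: L0 G_def f0 Pj0 geo_def)
    next
      case (Suc m)
      show ?thesis
      proof
        fix j
        have "of_nat n * L n $ j = (of_nat n * L n) $ j" by (simp flip: fps_of_nat)
        also have "\<dots> = (\<Sum>i=1..n. \<Sum>k=0..j. fps_const (A i $ k) * (1 - one_plus_y ^ i) * L (n - i) $ (j - k))"
          unfolding L by (simp only: fps_sum_nth AL)
        also have "\<dots> = (\<Sum>i=0..m. \<Sum>k=0..j. \<Gamma> k $ i * L (m - i) $ (j - k))"
          by (rule sum.reindex_bij_witness[of _ Suc "\<lambda>i. i - 1"]) (auto simp: Suc \<Gamma> simp del: power_Suc)
        also have "\<dots> = (\<Sum>i=0..m. \<Sum>k=0..j. \<Gamma> k $ i * G (j - k) $ (m - i))"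
          using less Suc by (intro sum.cong refl) auto
        also have "\<dots> = fps_deriv (G j) $ m"
          unfolding dG by (subst sum.swap) (simp add: fps_sum_nth fps_mult_nth)
        also have "\<dots> = of_nat n * G j $ n" by (simp add: Suc)
        finally show "L n $ j = G j $ n"
          by (simp add: Suc del: of_nat_Suc)
      qed
    qed
  qed
  then show ?thesis by (simp add: G_def)
qed

text \<open>
  In \<open>w\<^sup>j h(s) = \<Sum>\<^sub>i h\<^sub>i (-y)\<^sup>i t\<^sup>i w\<^bsup>i + j\<^esup>\<close> only \<open>i = r\<close> contributes to \<open>y\<^sup>r\<close>. The bound \<open>r \<ge> 1\<close>
  keeps the exponent of \<open>w\<close> positive, so that its coefficients are binomial coefficients.
\<close>

lemma at_s_coeff:
  fixes h :: "'a::idom fps"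
  assumes "r \<ge> 1" "n \<ge> 1"
  shows "(geo 1 ^ j * at_s h) $ n $ r =
    (-1) ^ r * (if r \<le> n then of_nat ((n + j - 1) choose (n - r)) else 0) * h $ r"
proof -
  let ?w = "geo 1 :: 'a fps fps"
  have s0: "subst_s ^ i $ m = (0 :: 'a fps)" if "m < i" for i m
    using that by (simp add: subst_s_eq power_mult_distrib fps_X_power_mult_nth)
  have sw: "(?w ^ j * subst_s ^ i) $ n = (- fps_X) ^ i * (if i \<le> n then (?w ^ (i + j)) $ (n - i) else 0)" for i
  proof -
    have "?w ^ j * subst_s ^ i = fps_const ((- fps_X) ^ i) * (fps_X ^ i * ?w ^ (i + j))"
      by (simp add: subst_s_eq power_mult_distrib power_add ac_simps flip: fps_const_power)
    then show ?thesis by (simp add: fps_X_power_mult_nth)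
  qed
  have wr: "(?w ^ (r + j)) $ (n - r) = of_nat ((n + j - 1) choose (n - r))" if "r \<le> n"
  proof -
    have "r + j = Suc (r + j - 1)" "n - r + (r + j - 1) = n + j - 1" using assms that by auto
    then have "(?w ^ (r + j)) $ (n - r) = of_nat ((n + j - 1) choose (r + j - 1))"
      by (metis geo_power_nth mult.right_neutral power_one)
    also have "(n + j - 1) choose (r + j - 1) = (n + j - 1) choose (n - r)"
      using assms that by (subst binomial_symmetric) (auto intro: arg_cong)
    finally show ?thesis .
  qed
  \<comment> \<open>The series \<open>w\<close> does not involve \<open>y\<close>.\<close>
  define d where "d = (\<lambda>i. (geo (1 :: 'a) ^ (i + j)) $ (n - i))"
  have d: "(?w ^ (i + j)) $ (n - i) = fps_const (d i)" for i
  proof -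
    have "?w = lift_fps (geo 1)" by (rule fps_ext) (simp add: geo_def)
    then show ?thesis by (simp add: d_def flip: lift_fps_power)
  qed
  have "(?w ^ j * at_s h) $ n = (\<Sum>a=0..n. ?w ^ j $ a * (\<Sum>i=0..n - a. fps_const (h $ i) * subst_s ^ i $ (n - a)))"
    by (simp add: fps_mult_nth fps_compose_nth)
  also have "\<dots> = (\<Sum>a=0..n. ?w ^ j $ a * (\<Sum>i=0..n. fps_const (h $ i) * subst_s ^ i $ (n - a)))"
    by (intro sum.cong arg_cong2[of _ _ _ _ "(*)"] refl sum.mono_neutral_left) (auto simp: s0)
  also have "\<dots> = (\<Sum>i=0..n. fps_const (h $ i) * (?w ^ j * subst_s ^ i) $ n)"
    unfolding fps_mult_nth sum_distrib_left by (subst sum.swap) (simp only: ac_simps)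
  finally have "(?w ^ j * at_s h) $ n $ r =
      (\<Sum>i=0..n. (fps_const (h $ i) * ((- fps_X) ^ i * fps_const (d i))) $ r)"
    unfolding fps_sum_nth[symmetric] by (intro arg_cong2[of _ _ _ _ fps_nth] sum.cong refl) (simp add: sw d)
  also have "\<dots> = (\<Sum>i=0..n. if i = r then h $ r * ((-1) ^ r * d r) else 0)"
  proof (rule sum.cong[OF refl])
    fix i
    have "(- fps_X) ^ i = fps_const ((-1) ^ i) * (fps_X ^ i :: 'a fps)"
      by (simp add: power_minus[of fps_X] flip: fps_const_power fps_const_neg)
    then show "(fps_const (h $ i) * ((- fps_X) ^ i * fps_const (d i))) $ r =
        (if i = r then h $ r * ((-1) ^ r * d r) else 0)"
      by (simp add: mult.assoc fps_X_power_nth)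
  qed
  also have "\<dots> = (-1) ^ r * (if r \<le> n then d r else 0) * h $ r"
    by simp
  also have "(if r \<le> n then d r else 0) = (if r \<le> n then of_nat ((n + j - 1) choose (n - r)) else 0)"
    using arg_cong[OF d[of r], of "\<lambda>f. f $ 0"] wr by (auto simp flip: fps_of_nat)
  finally show ?thesis .
qed

section \<open>The two sides of the identity\<close>

lemma prod_list_map_mult:
  "prod_list (map (\<lambda>i. f i * g i) xs) = prod_list (map f xs) * prod_list (map g xs :: 'a::comm_monoid_mult list)"
  by (induction xs) (simp_all add: ac_simps)

lemma prod_list_map_fps_const:
  "prod_list (map (\<lambda>i. fps_const (f i)) xs) = fps_const (prod_list (map f xs :: 'a::comm_ring_1 list))"
  by (induction xs) simp_all

lemma scal_zee_remove1:
  assumes "\<mu> \<in> partitions n" "i \<in> set \<mu>"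
  shows "of_nat (i * mpart \<mu> i) * scal (1 / zee \<mu>) = scal (1 / zee (remove1 i \<mu>))"
  by (simp only: zee_remove1[OF assms, symmetric] scal_mult scal_of_nat)

lemma Pjk_series:
  "Abs_fps (Pjk j) = (\<Sum>\<mu>\<in>partitions j. fps_const (scal (1 / zee \<mu>)) *
      prod_list (map (\<lambda>i. fps_const (var_X i) * ((1 + fps_X) ^ i - 1)) \<mu>))"
proof (rule fps_ext)
  fix k
  have "scal (of_nat (bracket \<mu> k) / zee \<mu>) = scal (1 / zee \<mu>) * of_nat (bracket \<mu> k)" for \<mu>
    using scal_mult[of "1 / zee \<mu>" "of_nat (bracket \<mu> k)"] by simp
  moreover have "prod_list (map (\<lambda>i. (1 + fps_X) ^ i - 1 :: qpoly fps) \<mu>) $ k = of_nat (bracket \<mu> k)" for \<mu>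
    by (simp only: bracket_fps[symmetric] fps_nth_Abs_fps)
  ultimately show "Abs_fps (Pjk j) $ k = (\<Sum>\<mu>\<in>partitions j. fps_const (scal (1 / zee \<mu>)) *
      prod_list (map (\<lambda>i. fps_const (var_X i) * ((1 + fps_X) ^ i - 1)) \<mu>)) $ k"
    by (simp only: Pjk_def fps_nth_Abs_fps fps_sum_nth prod_set_mpart prod_list_map_mult
        prod_list_map_fps_const fps_mult_left_const_nth) (simp only: ac_simps)
qed

lemma Pjk_series_newton:
  "of_nat j * Abs_fps (Pjk j) =
     (\<Sum>k=1..j. fps_const (var_X k) * ((1 + fps_X) ^ k - 1) * Abs_fps (Pjk (j - k)))"
  unfolding Pjk_series
proof (rule partition_sum_newton)
  fix \<mu> i n assume "\<mu> \<in> partitions n" "i \<in> set \<mu>"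
  then show "of_nat (i * mpart \<mu> i) * fps_const (scal (1 / zee \<mu>)) = fps_const (scal (1 / zee (remove1 i \<mu>)))"
    by (simp only: scal_zee_remove1[symmetric] fps_of_nat[symmetric] fps_const_mult)
qed

lemma Pjk_eq_0: "j < k \<Longrightarrow> Pjk j k = 0"
  unfolding Pjk_def by (rule sum.neutral) (auto simp: bracket_eq_0 partitions_def scal_def)

text \<open>
  The outer variable is \<open>u\<close>, the inner one \<open>y\<close>; the coefficients of \<open>y\<^sup>r\<close> are, up to the sign
  \<open>(-1)\<^sup>r\<close>, the left-hand sides of the identity.
\<close>

definition lhs_series :: "nat \<Rightarrow> qpoly fps fps" where
  "lhs_series n = (\<Sum>\<mu>\<in>partitions n. const2 (scal (1 / zee \<mu>)) *
      prod_list (map (\<lambda>i. lift_fps (zser i) * fps_const (1 - one_plus_y ^ i)) \<mu>))"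

lemma lhs_series_newton:
  "of_nat n * lhs_series n = (\<Sum>i=1..n. (lift_fps (zser i) * fps_const (1 - one_plus_y ^ i)) * lhs_series (n - i))"
  unfolding lhs_series_def
proof (rule partition_sum_newton)
  fix \<mu> i n assume "\<mu> \<in> partitions n" "i \<in> set \<mu>"
  then show "of_nat (i * mpart \<mu> i) * const2 (scal (1 / zee \<mu>)) = const2 (scal (1 / zee (remove1 i \<mu>)))"
    by (simp only: scal_zee_remove1[symmetric] fps_of_nat[symmetric] fps_const_mult)
qed

lemma scal_sign: "scal ((-1) powi (int r - int l) * of_nat b / z) = (-1) ^ r * ((-1) ^ l * of_nat b * scal (1 / z))"
proof -
  have "(-1 :: rat) powi (int r - int l) = (-1) ^ r * (-1) ^ l"
    by (simp add: power_int_diff field_simps flip: power_mult_distrib)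
  then have eq: "(-1) powi (int r - int l) * of_nat b / z = of_int ((-1) ^ r * ((-1) ^ l * int b)) * (1 / z)"
    by simp
  show ?thesis unfolding eq scal_mult scal_of_int by (simp add: ac_simps)
qed

lemma lhs_series_coeff:
  "(-1) ^ r * lhs_series n $ j $ r = (\<Sum>\<mu>\<in>partitions n.
      fps_const (scal ((-1) powi (int r - int (length \<mu>)) * of_nat (bracket \<mu> r) / zee \<mu>)) *
      (\<Prod>i\<in>set \<mu>. zser i ^ mpart \<mu> i)) $ j"
proof -
  have neg: "prod_list (map (\<lambda>i. 1 - one_plus_y ^ i :: qpoly fps) \<mu>) =
      fps_const ((-1) ^ length \<mu>) * Abs_fps (\<lambda>r. of_nat (bracket \<mu> r))" for \<mu>
    unfolding bracket_fps one_plus_y_def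
    by (induction \<mu>) (simp_all add: algebra_simps flip: fps_const_neg)
  have lift: "prod_list (map (\<lambda>i. lift_fps (zser i)) \<mu>) = lift_fps (prod_list (map zser \<mu>))" for \<mu>
    by (simp add: lift_fps_prod_list comp_def)
  have "(-1) ^ r * lhs_series n $ j $ r = (\<Sum>\<mu>\<in>partitions n. (-1) ^ r * (scal (1 / zee \<mu>) *
      (prod_list (map zser \<mu>) $ j * ((-1) ^ length \<mu> * of_nat (bracket \<mu> r)))))"
    by (simp add: lhs_series_def fps_sum_nth sum_distrib_left prod_list_map_mult
        prod_list_map_fps_const lift neg mult.assoc)
  then show ?thesis
    by (simp only: fps_sum_nth prod_set_mpart scal_sign fps_mult_left_const_nth) (simp only: ac_simps)
qed

lemma zser_0: "zser i $ 0 = var_z"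
  by (simp add: zser_def)

lemma zser_nth:
  assumes "k \<ge> 1"
  shows "zser (Suc i) $ k = of_nat ((i + k) choose k) * var_X k"
proof -
  have "(of_nat ((i + k) choose k) :: rat) = of_nat (i + k) gchoose k"
    by (rule binomial_gbinomial)
  also have "\<dots> = pochhammer (of_nat (Suc i)) k / fact k"
    by (simp add: gbinomial_pochhammer' add.commute)
  finally have "scal (pochhammer (of_nat (Suc i)) k / fact k) = of_nat ((i + k) choose k)"
    by (metis scal_of_nat)
  then show ?thesis using assms by (simp add: zser_def)
qed

theorem mainTheorem1:
  fixes n r :: nat
  assumes "n \<ge> 1" and "r \<ge> 1"
  shows "(\<Sum>\<mu>\<in>partitions n.
            fps_const (scal ((-1) powi (int r - int (length \<mu>)) * of_nat (bracket \<mu> r) / zee \<mu>)) *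
            (\<Prod>i\<in>set \<mu>. zser i ^ mpart \<mu> i)) =
         Abs_fps (\<lambda>j. binom (of_nat (n + j - 1)) (int n - int r) *
            (\<Sum>k=0..min r j. binom (var_z - of_nat j) (int r - int k) * Pjk j k))"
    (is "?L = ?R")
proof (rule fps_ext)
  fix j
  define h where "h = binomial_series (var_z - of_nat j) * Abs_fps (Pjk j)"
  have h: "h $ r = (\<Sum>k=0..min r j. binom (var_z - of_nat j) (int r - int k) * Pjk j k)"
  proof -
    have "h $ r = (\<Sum>k=0..r. binom (var_z - of_nat j) (int (r - k)) * Pjk j k)"
      unfolding h_def fps_mult_nth binomial_series_def
      by (rule sum.reindex_bij_witness[of _ "\<lambda>k. r - k" "\<lambda>k. r - k"]) auto
    also have "\<dots> = (\<Sum>k=0..min r j. binom (var_z - of_nat j) (int r - int k) * Pjk j k)"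
      by (rule sum.mono_neutral_cong_right) (auto simp: Pjk_eq_0 of_nat_diff)
    finally show ?thesis .
  qed
  have binser: "at_s (binomial_series var_z) = (1 + subst_s) ^ j * at_s (binomial_series (var_z - of_nat j))"
    unfolding binomial_series_diff[of j var_z, symmetric] by (simp only: at_s_mult at_s_power at_s_add at_s_X) simp
  have "lhs_series n $ j = (at_s (binomial_series var_z) * (geo one_plus_y ^ j * at_s (Abs_fps (Pjk j)))) $ n"
  proof (rule expansion_coeff_unique[where x = var_X and A = zser and a = var_z])
    show "Abs_fps (Pjk 0) = 1" by (simp add: Pjk_series partitions_0 zee_def)
    show "lhs_series 0 = 1" by (simp add: lhs_series_def partitions_0 zee_def)
    show "binomial_series var_z $ 0 = 1" by (simp add: binomial_series_def)
  qed (rule Pjk_series_newton lhs_series_newton binomial_series_deriv zser_0 zser_nth | assumption)+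
  also have "at_s (binomial_series var_z) * (geo one_plus_y ^ j * at_s (Abs_fps (Pjk j))) =
      (geo one_plus_y * (1 + subst_s)) ^ j * (at_s (binomial_series (var_z - of_nat j)) * at_s (Abs_fps (Pjk j)))"
    unfolding binser by (simp only: power_mult_distrib ac_simps)
  also have "\<dots> = geo 1 ^ j * at_s h"
    by (simp only: geo_subst_s h_def at_s_mult)
  finally have "lhs_series n $ j $ r =
      (-1) ^ r * (if r \<le> n then of_nat ((n + j - 1) choose (n - r)) else 0) * h $ r"
    by (simp only: at_s_coeff[OF assms(2,1)])
  moreover have "(if r \<le> n then of_nat ((n + j - 1) choose (n - r)) else 0) =
      binom (of_nat (n + j - 1)) (int n - int r)"
    using binom_of_nat[of "n + j - 1" "n - r"] by (auto simp: of_nat_diff)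
  ultimately have "(-1) ^ r * lhs_series n $ j $ r = ((-1) ^ r * (-1) ^ r) * (?R $ j)"
    by (simp add: h mult.assoc)
  moreover have "((-1) ^ r * (-1) ^ r :: qpoly) = 1"
    by (simp flip: power_mult_distrib)
  ultimately show "?L $ j = ?R $ j"
    by (simp only: lhs_series_coeff mult_1)
qed

end
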